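(* Let $X$ be a finite set and $S$ a set of subsets of $X\times X$ such that $(X,S)$ satisfies (CC1), (CC2) and (CC3), and let $(S,\nabla,e)$ be the associated monoid in $\mathbf{Mat}_{\mathbb R_0^+}$. Let $f\colon S\to I$ be a morphism in $\mathbf{Mat}_{\mathbb R_0^+}$ such that, for $a\in S$, $f_a^*>0$ if and only if $a\subseteq\mathrm{id}_X$. Then $f$ is a non-degenerate form on $(S,\nabla,e)$ if and only if $(X,S)$ is a coherent configuration, i.e. if and only if $(X,S)$ also satisfies (CC4).
   Context: $\mathbf{Mat}_{\mathbb R_0^+}$ is the category whose objects are finite sets and whose morphisms $f\colon X\to Y$ are matrices $(f_x^y)_{x\in X,y\in Y}$ of non-negative reals, with composition $(g\circ f)_a^c=\sum_{b}f_a^b g_b^c$. It is symmetric monoidal with $X\otimes Y=X\times Y$, $(f\otimes g)_{ac}^{bd}=f_a^b g_c^d$, unit object $I=\{*\}$, and structural isomorphisms (unitors $\lambda_A\colon I\otimes A\to A$, $\rho_A\colon A\otimes I\to A$, etc.) transferred from the cartesian structure on finite sets. Conditions on $(X,S)$ with $S$ a set of subsets of $X\times X$: (CC1) $S$ is a partition of $X\times X$. (CC2) If $p\in S$ and $(x,x)\in p$ for some $x$, then $p\subseteq\mathrm{id}_X$. (CC3) For $a,b,c\in S$ and $(x,y)\in c$, the number $\nabla_{ab}^c$ of $z\in X$ such that $(x,z)\in a$ and $(z,y)\in b$ does not depend on the choice of $(x,y)\in c$. (CC4) If $c\in S$ then $c^{-1}=\{(y,x):(x,y)\in c\}\in S$.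 A coherent configuration is a pair satisfying (CC1)–(CC4). For $(X,S)$ satisfying (CC1)–(CC3), the associated monoid is $(S,\nabla,e)$ with $\nabla\colon S\otimes S\to S$ the matrix of the numbers $\nabla_{ab}^c$, and $e\colon I\to S$ given by $e_*^a=1$ if $a\subseteq\mathrm{id}_X$ and $0$ otherwise (this is a monoid in $\mathbf{Mat}_{\mathbb R_0^+}$). A morphism $f\colon S\to I$ is a non-degenerate form on the monoid $(S,\nabla,e)$ if there is $\eta\colon I\to S\otimes S$ such that, with $\varepsilon=f\circ\nabla\colon S\otimes S\to I$, the snake identities hold: $\lambda_S\circ(\varepsilon\otimes\mathrm{id}_S)\circ(\mathrm{id}_S\otimes\eta)\circ\rho_S^{-1}=\mathrm{id}_S$ and $\rho_S\circ(\mathrm{id}_S\otimes\varepsilon)\circ(\eta\otimes\mathrm{id}_S)\circ\lambda_S^{-1}=\mathrm{id}_S$. *)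

theory Defs
  imports Complex_Main "HOL-Library.Disjoint_Sets"
begin

section \<open>Matrices of non-negative reals between finite sets\<close>

text \<open>
  A morphism from \<open>X\<close> to \<open>Y\<close> is represented by a function that vanishes outside \<open>X \<times> Y\<close>, so that
  equality of morphisms in a hom-set is equality in HOL. The operations below preserve this
  normalisation. Composition needs to know the middle object.
\<close>

type_synonym ('a, 'b) matrix = "'a \<Rightarrow> 'b \<Rightarrow> real"

definition mat_hom :: "'a set \<Rightarrow> 'b set \<Rightarrow> ('a, 'b) matrix set" where
  "mat_hom X Y = {f. (\<forall>x\<in>X. \<forall>y\<in>Y. 0 \<le> f x y) \<and> (\<forall>x y. x \<notin> X \<or> y \<notin> Y \<longrightarrow> f x y = 0)}"

definition mat_comp :: "('b, 'c) matrix \<Rightarrow> 'b set \<Rightarrow> ('a, 'b) matrix \<Rightarrow> ('a, 'c) matrix"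
    ("(_ \<circ>\<^bsub>_\<^esub>/ _)" [56, 0, 55] 55) where
  "g \<circ>\<^bsub>Y\<^esub> f = (\<lambda>a c. \<Sum>b\<in>Y. f a b * g b c)"

definition mat_tensor :: "('a, 'b) matrix \<Rightarrow> ('c, 'd) matrix \<Rightarrow> ('a \<times> 'c, 'b \<times> 'd) matrix"
    (infixr "\<otimes>\<^sub>m" 70) where
  "f \<otimes>\<^sub>m g = (\<lambda>(a, c) (b, d). f a b * g c d)"

definition mat_of_fun :: "'a set \<Rightarrow> 'b set \<Rightarrow> ('a \<Rightarrow> 'b) \<Rightarrow> ('a, 'b) matrix" where
  "mat_of_fun X Y h = (\<lambda>x y. if x \<in> X \<and> y \<in> Y \<and> h x = y then 1 else 0)"

definition mat_id :: "'a set \<Rightarrow> ('a, 'a) matrix" where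
  "mat_id A = mat_of_fun A A id"

abbreviation unit_obj :: "unit set" where
  "unit_obj \<equiv> {()}"

definition lunit :: "'a set \<Rightarrow> (unit \<times> 'a, 'a) matrix" where
  "lunit A = mat_of_fun (unit_obj \<times> A) A snd"

definition lunit_inv :: "'a set \<Rightarrow> ('a, unit \<times> 'a) matrix" where
  "lunit_inv A = mat_of_fun A (unit_obj \<times> A) (\<lambda>x. ((), x))"

definition runit :: "'a set \<Rightarrow> ('a \<times> unit, 'a) matrix" where
  "runit A = mat_of_fun (A \<times> unit_obj) A fst"

definition runit_inv :: "'a set \<Rightarrow> ('a, 'a \<times> unit) matrix" where
  "runit_inv A = mat_of_fun A (A \<times> unit_obj) (\<lambda>x. (x, ()))"

definition assoc :: "'a set \<Rightarrow> 'b set \<Rightarrow> 'c set \<Rightarrow> (('a \<times> 'b) \<times> 'c, 'a \<times> ('b \<times> 'c)) matrix" where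
  "assoc A B C = mat_of_fun ((A \<times> B) \<times> C) (A \<times> (B \<times> C)) (\<lambda>((x, y), z). (x, (y, z)))"

definition assoc_inv :: "'a set \<Rightarrow> 'b set \<Rightarrow> 'c set \<Rightarrow> ('a \<times> ('b \<times> 'c), ('a \<times> 'b) \<times> 'c) matrix" where
  "assoc_inv A B C = mat_of_fun (A \<times> (B \<times> C)) ((A \<times> B) \<times> C) (\<lambda>(x, (y, z)). ((x, y), z))"

definition mat_monoid :: "'a set \<Rightarrow> ('a \<times> 'a, 'a) matrix \<Rightarrow> (unit, 'a) matrix \<Rightarrow> bool" where
  "mat_monoid A m e \<longleftrightarrow>
     finite A \<and> m \<in> mat_hom (A \<times> A) A \<and> e \<in> mat_hom unit_obj A \<and>
     m \<circ>\<^bsub>A \<times> A\<^esub> (m \<otimes>\<^sub>m mat_id A) =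
       m \<circ>\<^bsub>A \<times> A\<^esub> (mat_id A \<otimes>\<^sub>m m) \<circ>\<^bsub>A \<times> (A \<times> A)\<^esub> assoc A A A \<and>
     m \<circ>\<^bsub>A \<times> A\<^esub> (e \<otimes>\<^sub>m mat_id A) = lunit A \<and>
     m \<circ>\<^bsub>A \<times> A\<^esub> (mat_id A \<otimes>\<^sub>m e) = runit A"

text \<open>The snake identities are usually written with the associators suppressed.\<close>

definition snake_identities ::
    "'a set \<Rightarrow> ('a \<times> 'a, unit) matrix \<Rightarrow> (unit, 'a \<times> 'a) matrix \<Rightarrow> bool" where
  "snake_identities A \<epsilon> \<eta> \<longleftrightarrow>
     lunit A \<circ>\<^bsub>unit_obj \<times> A\<^esub> (\<epsilon> \<otimes>\<^sub>m mat_id A) \<circ>\<^bsub>(A \<times> A) \<times> A\<^esub> assoc_inv A A A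
       \<circ>\<^bsub>A \<times> (A \<times> A)\<^esub> (mat_id A \<otimes>\<^sub>m \<eta>) \<circ>\<^bsub>A \<times> unit_obj\<^esub> runit_inv A = mat_id A \<and>
     runit A \<circ>\<^bsub>A \<times> unit_obj\<^esub> (mat_id A \<otimes>\<^sub>m \<epsilon>) \<circ>\<^bsub>A \<times> (A \<times> A)\<^esub> assoc A A A
       \<circ>\<^bsub>(A \<times> A) \<times> A\<^esub> (\<eta> \<otimes>\<^sub>m mat_id A) \<circ>\<^bsub>unit_obj \<times> A\<^esub> lunit_inv A = mat_id A"

definition nondegenerate_form ::
    "'a set \<Rightarrow> ('a \<times> 'a, 'a) matrix \<Rightarrow> (unit, 'a) matrix \<Rightarrow> ('a, unit) matrix \<Rightarrow> bool" where
  "nondegenerate_form A m e f \<longleftrightarrow>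
     mat_monoid A m e \<and> f \<in> mat_hom A unit_obj \<and>
     (\<exists>\<eta> \<in> mat_hom unit_obj (A \<times> A). snake_identities A (f \<circ>\<^bsub>A\<^esub> m) \<eta>)"


section \<open>Coherent configurations and the associated monoid\<close>

definition CC1 :: "'a set \<Rightarrow> 'a rel set \<Rightarrow> bool" where
  "CC1 X S \<longleftrightarrow> partition_on (X \<times> X) S"

definition CC2 :: "'a set \<Rightarrow> 'a rel set \<Rightarrow> bool" where
  "CC2 X S \<longleftrightarrow> (\<forall>p\<in>S. (\<exists>x. (x, x) \<in> p) \<longrightarrow> p \<subseteq> Id_on X)"

definition CC3 :: "'a set \<Rightarrow> 'a rel set \<Rightarrow> bool" where
  "CC3 X S \<longleftrightarrow>
     (\<forall>a\<in>S. \<forall>b\<in>S. \<forall>c\<in>S. \<exists>n. \<forall>(x, y)\<in>c. card {z \<in> X. (x, z) \<in> a \<and> (z, y) \<in> b} = n)"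

definition CC4 :: "'a rel set \<Rightarrow> bool" where
  "CC4 S \<longleftrightarrow> (\<forall>c\<in>S. c\<inverse> \<in> S)"

definition coherent_configuration :: "'a set \<Rightarrow> 'a rel set \<Rightarrow> bool" where
  "coherent_configuration X S \<longleftrightarrow> CC1 X S \<and> CC2 X S \<and> CC3 X S \<and> CC4 S"

text \<open>Well-defined for \<open>a, b, c \<in> S\<close> if CC1 and CC3 hold, since then \<open>c\<close> is non-empty.\<close>

definition intersection_number :: "'a set \<Rightarrow> 'a rel \<Rightarrow> 'a rel \<Rightarrow> 'a rel \<Rightarrow> nat" where
  "intersection_number X a b c =
     (THE n. \<forall>(x, y)\<in>c. card {z \<in> X. (x, z) \<in> a \<and> (z, y) \<in> b} = n)"

definition cc_mult :: "'a set \<Rightarrow> 'a rel set \<Rightarrow> ('a rel \<times> 'a rel, 'a rel) matrix" where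
  "cc_mult X S = (\<lambda>(a, b) c.
     if a \<in> S \<and> b \<in> S \<and> c \<in> S then real (intersection_number X a b c) else 0)"

definition cc_unit :: "'a set \<Rightarrow> 'a rel set \<Rightarrow> (unit, 'a rel) matrix" where
  "cc_unit X S = (\<lambda>_ a. if a \<in> S \<and> a \<subseteq> Id_on X then 1 else 0)"

end

theory Submission
  imports Defs
begin

text \<open>
  Put \<open>\<epsilon> = f \<circ> \<nabla>\<close>. Since \<open>f\<close> is positive exactly on the diagonal classes, \<open>\<epsilon> a b > 0\<close> holds
  if and only if \<open>b\<close> meets \<open>a\<inverse>\<close>. The snake identities say that \<open>\<epsilon>\<close> and \<open>\<eta>\<close>, read as square
  matrices indexed by \<open>S\<close>, are inverse to each other, and a non-negative matrix with a non-negative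
  inverse has exactly one positive entry in each row. So non-degeneracy says that every \<open>a\<inverse>\<close>
  meets only one class \<open>b\<close>, hence \<open>a\<inverse> \<subseteq> b\<close>; applying the same to \<open>b\<close> gives \<open>a\<inverse> = b\<close>.
  Conversely, under CC4 the matrix \<open>\<epsilon>\<close> is supported on the pairs \<open>(a, a\<inverse>)\<close>, and inverting its
  entries gives \<open>\<eta>\<close>.
\<close>

section \<open>Composition with structural morphisms\<close>

lemma mat_comp_mat_of_fun_right:
  assumes "finite Y" "h ` X \<subseteq> Y"
  shows "(g \<circ>\<^bsub>Y\<^esub> mat_of_fun X Y h) = (\<lambda>a c. if a \<in> X then g (h a) c else 0)"
proof (intro ext)
  fix a c
  have "(\<Sum>b\<in>Y. mat_of_fun X Y h a b * g b c) = (\<Sum>b\<in>Y. if h a = b then if a \<in> X then g b c else 0 else 0)"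
    by (rule sum.cong) (auto simp: mat_of_fun_def)
  then show "(g \<circ>\<^bsub>Y\<^esub> mat_of_fun X Y h) a c = (if a \<in> X then g (h a) c else 0)"
    using assms by (auto simp: mat_comp_def)
qed

text \<open>Composing with a function on this side sums over its fibres. The hypotheses say that the
  fibre of \<open>h\<close> over \<open>z\<close> is the single point \<open>k z\<close>, so the
  composite is a relabelling along the inverse \<open>k\<close>.\<close>

lemma mat_comp_mat_of_fun_left:
  assumes "finite Y" "\<And>y z. y \<in> Y \<Longrightarrow> z \<in> Z \<Longrightarrow> h y = z \<longleftrightarrow> y = k z" "k ` Z \<subseteq> Y"
  shows "(mat_of_fun Y Z h \<circ>\<^bsub>Y\<^esub> f) = (\<lambda>a c. if c \<in> Z then f a (k c) else 0)"
proof (intro ext)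
  fix a c
  have "(\<Sum>b\<in>Y. f a b * mat_of_fun Y Z h b c) = (\<Sum>b\<in>Y. if k c = b then if c \<in> Z then f a b else 0 else 0)"
    using assms(2) by (intro sum.cong) (auto simp: mat_of_fun_def)
  then show "(mat_of_fun Y Z h \<circ>\<^bsub>Y\<^esub> f) a c = (if c \<in> Z then f a (k c) else 0)"
    using assms by (auto simp: mat_comp_def)
qed

lemma mat_id_apply: "mat_id A a b = (if a \<in> A \<and> a = b then 1 else 0)"
  by (auto simp: mat_id_def mat_of_fun_def)

text \<open>The identity factor is a Kronecker delta and collapses one of the two sums over the
  middle object. Together with the next three lemmas this covers both sides of the tensor and both
  sides of the composition.\<close>

lemma mat_comp_tensor_id_right:
  assumes "finite A"
  shows "(g \<circ>\<^bsub>Y \<times> A\<^esub> (f \<otimes>\<^sub>m mat_id A)) (a, c) d = (if c \<in> A then \<Sum>b\<in>Y. f a b * g (b, c) d else 0)"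
proof -
  have "(g \<circ>\<^bsub>Y \<times> A\<^esub> (f \<otimes>\<^sub>m mat_id A)) (a, c) d
      = (\<Sum>b\<in>Y. \<Sum>b'\<in>A. if c = b' then f a b * g (b, b') d else 0)"
    by (auto simp: mat_comp_def mat_tensor_def sum.cartesian_product mat_id_apply intro!: sum.cong)
  then show ?thesis using assms by simp
qed

lemma mat_comp_tensor_id_left:
  assumes "finite A"
  shows "(g \<circ>\<^bsub>A \<times> Y\<^esub> (mat_id A \<otimes>\<^sub>m f)) (c, a) d = (if c \<in> A then \<Sum>b\<in>Y. f a b * g (c, b) d else 0)"
proof -
  have "(g \<circ>\<^bsub>A \<times> Y\<^esub> (mat_id A \<otimes>\<^sub>m f)) (c, a) d
      = (\<Sum>b'\<in>A. \<Sum>b\<in>Y. if c = b' then f a b * g (b', b) d else 0)"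
    by (auto simp: mat_comp_def mat_tensor_def sum.cartesian_product mat_id_apply intro!: sum.cong)
  also have "\<dots> = (\<Sum>b'\<in>A. if c = b' then \<Sum>b\<in>Y. f a b * g (b', b) d else 0)"
    by (intro sum.cong) auto
  finally show ?thesis using assms by simp
qed

lemma mat_comp_id_tensor_right:
  assumes "finite A"
  shows "((f \<otimes>\<^sub>m mat_id A) \<circ>\<^bsub>Y \<times> A\<^esub> g) a (d, c) = (if c \<in> A then \<Sum>b\<in>Y. g a (b, c) * f b d else 0)"
proof -
  have "((f \<otimes>\<^sub>m mat_id A) \<circ>\<^bsub>Y \<times> A\<^esub> g) a (d, c)
      = (\<Sum>b\<in>Y. \<Sum>b'\<in>A. if c = b' then g a (b, b') * f b d else 0)"
    by (auto simp: mat_comp_def mat_tensor_def sum.cartesian_product mat_id_apply intro!: sum.cong)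
  then show ?thesis using assms by simp
qed

lemma mat_comp_id_tensor_left:
  assumes "finite A"
  shows "((mat_id A \<otimes>\<^sub>m f) \<circ>\<^bsub>A \<times> Y\<^esub> g) a (c, d) = (if c \<in> A then \<Sum>b\<in>Y. g a (c, b) * f b d else 0)"
proof -
  have "((mat_id A \<otimes>\<^sub>m f) \<circ>\<^bsub>A \<times> Y\<^esub> g) a (c, d)
      = (\<Sum>b'\<in>A. \<Sum>b\<in>Y. if c = b' then g a (b', b) * f b d else 0)"
    by (auto simp: mat_comp_def mat_tensor_def sum.cartesian_product mat_id_apply intro!: sum.cong)
  also have "\<dots> = (\<Sum>b'\<in>A. if c = b' then \<Sum>b\<in>Y. g a (b', b) * f b d else 0)"
    by (intro sum.cong) auto
  finally show ?thesis using assms by simp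
qed

section \<open>The snake identities as matrix equations\<close>

text \<open>Follow the index \<open>a\<close>: \<open>\<eta>\<close> creates a pair
  \<open>(b, c)\<close> to its right, \<open>\<epsilon>\<close> consumes \<open>(a, b)\<close>, and
  \<open>c\<close> is left over. All other factors are deltas, so only the sum over \<open>b\<close>
  survives.\<close>

lemma left_snake_apply:
  fixes A :: "'b set"
  assumes "finite A"
  shows "(lunit A \<circ>\<^bsub>unit_obj \<times> A\<^esub> (\<epsilon> \<otimes>\<^sub>m mat_id A) \<circ>\<^bsub>(A \<times> A) \<times> A\<^esub> assoc_inv A A A
       \<circ>\<^bsub>A \<times> (A \<times> A)\<^esub> (mat_id A \<otimes>\<^sub>m \<eta>) \<circ>\<^bsub>A \<times> unit_obj\<^esub> runit_inv A) a c
    = (if a \<in> A \<and> c \<in> A then \<Sum>b\<in>A. \<eta> () (b, c) * \<epsilon> (a, b) () else 0)"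
proof -
  \<comment> \<open>Each structural isomorphism only relabels indices. Composition associates to the
    right, so these equations peel the isomorphisms off one after another.\<close>
  have lunit: "(lunit A \<circ>\<^bsub>unit_obj \<times> A\<^esub> h) = (\<lambda>a c. if c \<in> A then h a ((), c) else 0)"
    for h :: "('d, unit \<times> 'b) matrix"
    unfolding lunit_def using assms by (intro mat_comp_mat_of_fun_left) auto
  have assoc: "(assoc_inv A A A \<circ>\<^bsub>A \<times> (A \<times> A)\<^esub> h)
      = (\<lambda>a t. if t \<in> (A \<times> A) \<times> A then h a ((\<lambda>((x, y), z). (x, (y, z))) t) else 0)"
    for h :: "('b, 'b \<times> 'b \<times> 'b) matrix"
    unfolding assoc_inv_def using assms by (intro mat_comp_mat_of_fun_left) auto
  have runit: "(h \<circ>\<^bsub>A \<times> unit_obj\<^esub> runit_inv A) = (\<lambda>a t. if a \<in> A then h (a, ()) t else 0)"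
    for h :: "('b \<times> unit, 'b \<times> 'b \<times> 'b) matrix"
    unfolding runit_inv_def using assms by (intro mat_comp_mat_of_fun_right) auto
  have "(\<Sum>t\<in>A \<times> A. (mat_id A \<otimes>\<^sub>m \<eta>) (a, ()) (fst t, (snd t, c)) * \<epsilon> t ())
      = (\<Sum>x\<in>A. \<Sum>y\<in>A. if a = x then \<eta> () (y, c) * \<epsilon> (x, y) () else 0)"
    by (auto simp: sum.cartesian_product mat_id_apply mat_tensor_def intro!: sum.cong)
  also have "\<dots> = (\<Sum>x\<in>A. if a = x then \<Sum>y\<in>A. \<eta> () (y, c) * \<epsilon> (x, y) () else 0)"
    by (intro sum.cong) auto
  finally have *: "(\<Sum>t\<in>A \<times> A. (mat_id A \<otimes>\<^sub>m \<eta>) (a, ()) (fst t, (snd t, c)) * \<epsilon> t ())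
      = (if a \<in> A then \<Sum>b\<in>A. \<eta> () (b, c) * \<epsilon> (a, b) () else 0)"
    using assms by simp
  then show ?thesis
    unfolding lunit assoc runit mat_comp_id_tensor_right[OF assms]
    by (auto simp: case_prod_unfold intro!: sum.cong)
qed

text \<open>Here \<open>\<eta>\<close> creates \<open>(b, c)\<close> to the left of
  \<open>a\<close>, \<open>\<epsilon>\<close> consumes \<open>(c, a)\<close>, and the output is
  \<open>b\<close>.\<close>

lemma right_snake_apply:
  fixes A :: "'b set"
  assumes "finite A"
  shows "(runit A \<circ>\<^bsub>A \<times> unit_obj\<^esub> (mat_id A \<otimes>\<^sub>m \<epsilon>) \<circ>\<^bsub>A \<times> (A \<times> A)\<^esub> assoc A A A
       \<circ>\<^bsub>(A \<times> A) \<times> A\<^esub> (\<eta> \<otimes>\<^sub>m mat_id A) \<circ>\<^bsub>unit_obj \<times> A\<^esub> lunit_inv A) a b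
    = (if a \<in> A \<and> b \<in> A then \<Sum>c\<in>A. \<eta> () (b, c) * \<epsilon> (c, a) () else 0)"
proof -
  have runit: "(runit A \<circ>\<^bsub>A \<times> unit_obj\<^esub> h) = (\<lambda>a c. if c \<in> A then h a (c, ()) else 0)"
    for h :: "('d, 'b \<times> unit) matrix"
    unfolding runit_def using assms by (intro mat_comp_mat_of_fun_left) auto
  have assoc: "(assoc A A A \<circ>\<^bsub>(A \<times> A) \<times> A\<^esub> h)
      = (\<lambda>a t. if t \<in> A \<times> (A \<times> A) then h a ((\<lambda>(x, (y, z)). ((x, y), z)) t) else 0)"
    for h :: "('b, ('b \<times> 'b) \<times> 'b) matrix"
    unfolding assoc_def using assms by (intro mat_comp_mat_of_fun_left) auto
  have lunit: "(h \<circ>\<^bsub>unit_obj \<times> A\<^esub> lunit_inv A) = (\<lambda>a t. if a \<in> A then h ((), a) t else 0)"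
    for h :: "(unit \<times> 'b, ('b \<times> 'b) \<times> 'b) matrix"
    unfolding lunit_inv_def using assms by (intro mat_comp_mat_of_fun_right) auto
  have "(\<Sum>t\<in>A \<times> A. (\<eta> \<otimes>\<^sub>m mat_id A) ((), a) ((b, fst t), snd t) * \<epsilon> t ())
      = (\<Sum>x\<in>A. \<Sum>y\<in>A. if a = y then \<eta> () (b, x) * \<epsilon> (x, y) () else 0)"
    by (auto simp: sum.cartesian_product mat_id_apply mat_tensor_def intro!: sum.cong)
  then have *: "(\<Sum>t\<in>A \<times> A. (\<eta> \<otimes>\<^sub>m mat_id A) ((), a) ((b, fst t), snd t) * \<epsilon> t ())
      = (if a \<in> A then \<Sum>c\<in>A. \<eta> () (b, c) * \<epsilon> (c, a) () else 0)"
    using assms by simp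
  then show ?thesis
    unfolding lunit assoc runit mat_comp_id_tensor_left[OF assms]
    by (auto simp: case_prod_unfold intro!: sum.cong)
qed

text \<open>With E the matrix of \<open>\<epsilon>\<close> and H that of \<open>\<eta>\<close>, the
  two families say EH = 1 and HE = 1. Indices outside \<open>A\<close> impose nothing, as both sides
  vanish there.\<close>

lemma snake_identities_iff:
  assumes "finite A"
  shows "snake_identities A \<epsilon> \<eta> \<longleftrightarrow>
     (\<forall>a\<in>A. \<forall>c\<in>A. (\<Sum>b\<in>A. \<eta> () (b, c) * \<epsilon> (a, b) ()) = of_bool (a = c)) \<and>
     (\<forall>a\<in>A. \<forall>b\<in>A. (\<Sum>c\<in>A. \<eta> () (b, c) * \<epsilon> (c, a) ()) = of_bool (a = b))"
  unfolding snake_identities_def fun_eq_iff left_snake_apply[OF assms] right_snake_apply[OF assms]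
    mat_id_apply
  by auto

text \<open>The diagonal entry of EH at \<open>a\<close> is 1, so some product of
  \<open>E a b\<close> and \<open>H b a\<close> is positive. A second positive entry
  \<open>E a b'\<close> would make the off-diagonal entry of HE at \<open>(b, b')\<close> positive,
  since no terms can cancel.\<close>

lemma nonneg_inverse_unique_entry:
  fixes E H :: "'b \<Rightarrow> 'b \<Rightarrow> real"
  assumes "finite A" "\<And>a b. a \<in> A \<Longrightarrow> b \<in> A \<Longrightarrow> 0 \<le> E a b" "\<And>a b. a \<in> A \<Longrightarrow> b \<in> A \<Longrightarrow> 0 \<le> H a b"
    and EH: "\<And>a c. a \<in> A \<Longrightarrow> c \<in> A \<Longrightarrow> (\<Sum>b\<in>A. H b c * E a b) = of_bool (a = c)"
    and HE: "\<And>a b. a \<in> A \<Longrightarrow> b \<in> A \<Longrightarrow> (\<Sum>c\<in>A. H b c * E c a) = of_bool (a = b)"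
    and "a \<in> A"
  obtains b where "b \<in> A" "E a b > 0" "\<And>b'. b' \<in> A \<Longrightarrow> E a b' > 0 \<Longrightarrow> b' = b"
proof -
  have "(\<Sum>b\<in>A. H b a * E a b) \<noteq> 0"
    using EH[of a a] \<open>a \<in> A\<close> by simp
  then obtain b where b: "b \<in> A" "H b a * E a b \<noteq> 0"
    by (meson sum.not_neutral_contains_not_neutral)
  then have pos: "H b a > 0" "E a b > 0"
    using assms(2)[of a b] assms(3)[of b a] \<open>a \<in> A\<close> by (auto simp: less_le)
  have "b' = b" if "b' \<in> A" "E a b' > 0" for b'
  proof (rule ccontr)
    assume "b' \<noteq> b"
    then have "(\<Sum>c\<in>A. H b c * E c b') = 0"
      using HE[of b' b] b that by simp
    then have "H b a * E a b' = 0"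
      using sum_nonneg_eq_0_iff[of A "\<lambda>c. H b c * E c b'"] assms(1-3) \<open>a \<in> A\<close> b that by auto
    then show False using pos that by simp
  qed
  then show thesis using that b pos by blast
qed

section \<open>The monoid associated with a configuration\<close>

text \<open>CC4 is left out, so that both directions of the equivalence can be proved in this
  context.\<close>

locale configuration =
  fixes X :: "'a set" and S :: "'a rel set"
  assumes finite_X: "finite X" and CC1: "CC1 X S" and CC2: "CC2 X S" and CC3: "CC3 X S"
begin

lemma partition_on_S: "partition_on (X \<times> X) S"
  using CC1 by (simp add: CC1_def)

lemma finite_S: "finite S"
  using finite_elements[OF _ partition_on_S] finite_X by simp

lemma class_subset: "a \<in> S \<Longrightarrow> a \<subseteq> X \<times> X"
  using partition_onD1[OF partition_on_S] by auto

lemma class_nonempty: "a \<in> S \<Longrightarrow> \<exists>x y. (x, y) \<in> a"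
  using partition_onD3[OF partition_on_S] by (metis equals0I surj_pair)

lemma ex_class: "t \<in> X \<times> X \<Longrightarrow> \<exists>a\<in>S. t \<in> a"
  using partition_onD1[OF partition_on_S] by auto

lemma class_eqI: "a \<in> S \<Longrightarrow> b \<in> S \<Longrightarrow> t \<in> a \<Longrightarrow> t \<in> b \<Longrightarrow> a = b"
  using partition_onD2[OF partition_on_S] by (auto simp: disjoint_def)

lemma class_subset_Id: "a \<in> S \<Longrightarrow> (x, x) \<in> a \<Longrightarrow> a \<subseteq> Id_on X"
  using CC2 by (auto simp: CC2_def)

section \<open>Intersection numbers as sums of indicators\<close>

lemma intersection_number_eq:
  assumes "a \<in> S" "b \<in> S" "c \<in> S" "(x, y) \<in> c"
  shows "intersection_number X a b c = card {z \<in> X. (x, z) \<in> a \<and> (z, y) \<in> b}"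
proof -
  obtain n where n: "\<forall>(x, y)\<in>c. card {z \<in> X. (x, z) \<in> a \<and> (z, y) \<in> b} = n"
    using CC3 assms unfolding CC3_def by blast
  then have "intersection_number X a b c = n"
    unfolding intersection_number_def using assms(4) by (intro the_equality) auto
  then show ?thesis using n assms(4) by auto
qed

text \<open>In this form the monoid laws become interchanges of finite sums. The representative
  \<open>(x, y)\<close> of \<open>c\<close> may be chosen freely.\<close>

lemma cc_mult_eq:
  assumes "a \<in> S" "b \<in> S" "c \<in> S" "(x, y) \<in> c"
  shows "cc_mult X S (a, b) c = (\<Sum>z\<in>X. of_bool ((x, z) \<in> a) * of_bool ((z, y) \<in> b))"
proof -
  have "(\<Sum>z\<in>X. of_bool ((x, z) \<in> a) * of_bool ((z, y) \<in> b))
      = (\<Sum>z\<in>X. of_bool ((x, z) \<in> a \<and> (z, y) \<in> b) :: real)"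
    by (intro sum.cong) auto
  also have "\<dots> = real (card {z \<in> X. (x, z) \<in> a \<and> (z, y) \<in> b})"
    using finite_X by (simp add: Int_def of_bool_def sum.If_cases)
  finally show ?thesis
    using assms by (simp add: cc_mult_def intersection_number_eq[OF assms])
qed

lemma cc_mult_nonneg: "cc_mult X S p c \<ge> 0"
  by (auto simp: cc_mult_def split: prod.split)

text \<open>Exactly one class contains \<open>t\<close>. This is the bridge between sums over
  classes and sums over points.\<close>

lemma sum_class_mult:
  fixes g :: "'a rel \<Rightarrow> real"
  assumes "t \<in> c" "c \<in> S"
  shows "(\<Sum>p\<in>S. of_bool (t \<in> p) * g p) = g c"
proof -
  have "(\<Sum>p\<in>S. of_bool (t \<in> p) * g p) = (\<Sum>p\<in>S. if c = p then g p else 0)"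
  proof (rule sum.cong[OF refl])
    fix p assume "p \<in> S"
    then have "t \<in> p \<longleftrightarrow> c = p"
      using class_eqI[OF assms(2) _ assms(1)] assms by blast
    then show "of_bool (t \<in> p) * g p = (if c = p then g p else 0)" by simp
  qed
  then show ?thesis using finite_S assms by simp
qed

text \<open>Fix \<open>(x, y)\<close> in \<open>d\<close>. Both sides count the pairs
  \<open>(z, w)\<close> with \<open>(x, z)\<close> in \<open>a\<close>, \<open>(z, w)\<close> in
  \<open>b\<close> and \<open>(w, y)\<close> in \<open>c\<close>: the left side sorts them by the
  class of \<open>(x, w)\<close>, the right side by the class of \<open>(z, y)\<close>.\<close>

lemma cc_mult_assoc:
  assumes "a \<in> S" "b \<in> S" "c \<in> S" "d \<in> S"
  shows "(\<Sum>p\<in>S. cc_mult X S (a, b) p * cc_mult X S (p, c) d)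
    = (\<Sum>q\<in>S. cc_mult X S (b, c) q * cc_mult X S (a, q) d)"
proof -
  obtain x y where xy: "(x, y) \<in> d"
    using class_nonempty assms by blast
  then have "x \<in> X" "y \<in> X"
    using class_subset assms by auto
  have "(\<Sum>p\<in>S. cc_mult X S (a, b) p * cc_mult X S (p, c) d)
      = (\<Sum>p\<in>S. \<Sum>w\<in>X. of_bool ((w, y) \<in> c) * (of_bool ((x, w) \<in> p) * cc_mult X S (a, b) p))"
    using assms xy by (simp add: cc_mult_eq[OF _ _ _ xy] sum_distrib_left mult_ac)
  also have "\<dots> = (\<Sum>w\<in>X. of_bool ((w, y) \<in> c) * (\<Sum>p\<in>S. of_bool ((x, w) \<in> p) * cc_mult X S (a, b) p))"
    by (subst sum.swap) (simp add: sum_distrib_left)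
  \<comment> \<open>For each \<open>w\<close> only the class \<open>p\<close> of
    \<open>(x, w)\<close> contributes, and its coefficient may be computed at the representative
    \<open>(x, w)\<close>.\<close>
  also have "\<dots> = (\<Sum>w\<in>X. of_bool ((w, y) \<in> c) * (\<Sum>z\<in>X. of_bool ((x, z) \<in> a) * of_bool ((z, w) \<in> b)))"
  proof (intro sum.cong refl arg_cong2[where f = "(*)"])
    fix w assume "w \<in> X"
    then obtain p where p: "p \<in> S" "(x, w) \<in> p"
      using ex_class[of "(x, w)"] \<open>x \<in> X\<close> by auto
    then show "(\<Sum>p\<in>S. of_bool ((x, w) \<in> p) * cc_mult X S (a, b) p)
        = (\<Sum>z\<in>X. of_bool ((x, z) \<in> a) * of_bool ((z, w) \<in> b))"
      using assms by (subst sum_class_mult[where c = p]) (auto intro!: cc_mult_eq)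
  qed
  also have "\<dots> = (\<Sum>z\<in>X. of_bool ((x, z) \<in> a) * (\<Sum>w\<in>X. of_bool ((z, w) \<in> b) * of_bool ((w, y) \<in> c)))"
    unfolding sum_distrib_left by (subst sum.swap) (simp add: mult_ac)
  \<comment> \<open>The same device in reverse: the inner count is the coefficient of the class
    \<open>q\<close> of \<open>(z, y)\<close>.\<close>
  also have "\<dots> = (\<Sum>z\<in>X. of_bool ((x, z) \<in> a) * (\<Sum>q\<in>S. of_bool ((z, y) \<in> q) * cc_mult X S (b, c) q))"
  proof (intro sum.cong refl arg_cong2[where f = "(*)"])
    fix z assume "z \<in> X"
    then obtain q where q: "q \<in> S" "(z, y) \<in> q"
      using ex_class[of "(z, y)"] \<open>y \<in> X\<close> by auto
    then show "(\<Sum>w\<in>X. of_bool ((z, w) \<in> b) * of_bool ((w, y) \<in> c))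
        = (\<Sum>q\<in>S. of_bool ((z, y) \<in> q) * cc_mult X S (b, c) q)"
      using assms by (subst sum_class_mult[where c = q]) (auto intro!: cc_mult_eq[symmetric])
  qed
  also have "\<dots> = (\<Sum>q\<in>S. \<Sum>z\<in>X. of_bool ((x, z) \<in> a) * (of_bool ((z, y) \<in> q) * cc_mult X S (b, c) q))"
    unfolding sum_distrib_left by (rule sum.swap)
  also have "\<dots> = (\<Sum>q\<in>S. cc_mult X S (b, c) q * cc_mult X S (a, q) d)"
    using assms xy by (simp add: cc_mult_eq[OF _ _ _ xy] sum_distrib_left mult_ac)
  finally show ?thesis .
qed

text \<open>By CC2 the class of \<open>(x, z)\<close> lies in the diagonal exactly when
  \<open>x = z\<close>, so the unit encodes the indicator of the diagonal.\<close>

lemma sum_cc_unit: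
  assumes "x \<in> X" "z \<in> X"
  shows "(\<Sum>a\<in>S. cc_unit X S () a * of_bool ((x, z) \<in> a)) = of_bool (x = z)"
proof -
  obtain c where c: "c \<in> S" "(x, z) \<in> c"
    using ex_class[of "(x, z)"] assms by auto
  have "(\<Sum>a\<in>S. cc_unit X S () a * of_bool ((x, z) \<in> a)) = cc_unit X S () c"
    using sum_class_mult[OF c(2,1), of "cc_unit X S ()"] by (simp add: mult.commute)
  also have "\<dots> = of_bool (x = z)"
    using c class_subset_Id[of c] by (auto simp: cc_unit_def)
  finally show ?thesis .
qed

text \<open>At a representative \<open>(x, y)\<close> of \<open>c\<close>, the unit forces the
  intermediate point to be \<open>x\<close>. What remains is whether \<open>(x, y)\<close> lies in
  \<open>b\<close>, that is, whether \<open>b = c\<close>.\<close>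

lemma cc_mult_unit_left:
  assumes "b \<in> S" "c \<in> S"
  shows "(\<Sum>a\<in>S. cc_unit X S () a * cc_mult X S (a, b) c) = of_bool (b = c)"
proof -
  obtain x y where xy: "(x, y) \<in> c"
    using class_nonempty assms by blast
  then have "x \<in> X" "y \<in> X"
    using class_subset assms by auto
  have "(\<Sum>a\<in>S. cc_unit X S () a * cc_mult X S (a, b) c)
      = (\<Sum>a\<in>S. \<Sum>z\<in>X. of_bool ((z, y) \<in> b) * (cc_unit X S () a * of_bool ((x, z) \<in> a)))"
    using assms by (simp add: cc_mult_eq[OF _ _ _ xy] sum_distrib_left mult_ac)
  also have "\<dots> = (\<Sum>z\<in>X. of_bool ((z, y) \<in> b) * (\<Sum>a\<in>S. cc_unit X S () a * of_bool ((x, z) \<in> a)))"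
    by (subst sum.swap) (simp add: sum_distrib_left)
  also have "\<dots> = (\<Sum>z\<in>X. if x = z then of_bool ((z, y) \<in> b) else 0)"
    using \<open>x \<in> X\<close> by (intro sum.cong) (auto simp: sum_cc_unit)
  also have "\<dots> = of_bool (b = c)"
    using finite_X \<open>x \<in> X\<close> assms xy class_eqI by auto
  finally show ?thesis .
qed

lemma cc_mult_unit_right:
  assumes "b \<in> S" "c \<in> S"
  shows "(\<Sum>a\<in>S. cc_unit X S () a * cc_mult X S (b, a) c) = of_bool (b = c)"
proof -
  obtain x y where xy: "(x, y) \<in> c"
    using class_nonempty assms by blast
  then have "x \<in> X" "y \<in> X"
    using class_subset assms by auto
  have "(\<Sum>a\<in>S. cc_unit X S () a * cc_mult X S (b, a) c)
      = (\<Sum>a\<in>S. \<Sum>z\<in>X. of_bool ((x, z) \<in> b) * (cc_unit X S () a * of_bool ((z, y) \<in> a)))"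
    using assms by (simp add: cc_mult_eq[OF _ _ _ xy] sum_distrib_left mult_ac)
  also have "\<dots> = (\<Sum>z\<in>X. of_bool ((x, z) \<in> b) * (\<Sum>a\<in>S. cc_unit X S () a * of_bool ((z, y) \<in> a)))"
    by (subst sum.swap) (simp add: sum_distrib_left)
  also have "\<dots> = (\<Sum>z\<in>X. if y = z then of_bool ((x, z) \<in> b) else 0)"
    using \<open>y \<in> X\<close> by (intro sum.cong) (auto simp: sum_cc_unit)
  also have "\<dots> = of_bool (b = c)"
    using finite_X \<open>y \<in> X\<close> assms xy class_eqI by auto
  finally show ?thesis .
qed

lemma mat_monoid_cc: "mat_monoid S (cc_mult X S) (cc_unit X S)"
proof -
  let ?m = "cc_mult X S"
  have "?m \<circ>\<^bsub>S \<times> S\<^esub> (?m \<otimes>\<^sub>m mat_id S) = ?m \<circ>\<^bsub>S \<times> S\<^esub> (mat_id S \<otimes>\<^sub>m ?m) \<circ>\<^bsub>S \<times> (S \<times> S)\<^esub> assoc S S S"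
  proof (intro ext)
    fix t :: "('a rel \<times> 'a rel) \<times> 'a rel" and d
    obtain a b c where t: "t = ((a, b), c)" by (metis surj_pair)
    have assoc: "(h \<circ>\<^bsub>S \<times> (S \<times> S)\<^esub> assoc S S S) t d
        = (if t \<in> (S \<times> S) \<times> S then h (a, (b, c)) d else 0)"
      for h :: "('a rel \<times> 'a rel \<times> 'a rel, 'a rel \<times> 'a rel) matrix" and d
      unfolding assoc_def using finite_S by (subst mat_comp_mat_of_fun_right) (auto simp: t)
    have "(?m \<circ>\<^bsub>S \<times> S\<^esub> (mat_id S \<otimes>\<^sub>m ?m) \<circ>\<^bsub>S \<times> (S \<times> S)\<^esub> assoc S S S) t d
        = (if t \<in> (S \<times> S) \<times> S then (?m \<circ>\<^bsub>S \<times> S\<^esub> (mat_id S \<otimes>\<^sub>m ?m)) (a, (b, c)) d else 0)"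
      by (simp add: mat_comp_def[of ?m] assoc)
    also have "\<dots> = (if t \<in> (S \<times> S) \<times> S then \<Sum>q\<in>S. ?m (b, c) q * ?m (a, q) d else 0)"
      by (auto simp: t mat_comp_tensor_id_left[OF finite_S])
    \<comment> \<open>The two guards differ, but when \<open>a\<close>, \<open>b\<close> or
      \<open>d\<close> lies outside \<open>S\<close> every summand is zero because
      \<open>cc_mult\<close> vanishes there.\<close>
    also have "\<dots> = (if c \<in> S then \<Sum>p\<in>S. ?m (a, b) p * ?m (p, c) d else 0)"
    proof (cases "t \<in> (S \<times> S) \<times> S \<and> d \<in> S")
      case True
      then show ?thesis using cc_mult_assoc[of a b c d] by (simp add: t)
    next
      case False
      then show ?thesis by (auto simp: t cc_mult_def)
    qed
    also have "\<dots> = (?m \<circ>\<^bsub>S \<times> S\<^esub> (?m \<otimes>\<^sub>m mat_id S)) t d"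
      by (simp add: t mat_comp_tensor_id_right[OF finite_S])
    finally show "(?m \<circ>\<^bsub>S \<times> S\<^esub> (?m \<otimes>\<^sub>m mat_id S)) t d
        = (?m \<circ>\<^bsub>S \<times> S\<^esub> (mat_id S \<otimes>\<^sub>m ?m) \<circ>\<^bsub>S \<times> (S \<times> S)\<^esub> assoc S S S) t d" ..
  qed
  moreover have "?m \<circ>\<^bsub>S \<times> S\<^esub> (cc_unit X S \<otimes>\<^sub>m mat_id S) = lunit S"
  proof (intro ext)
    fix t c
    show "(?m \<circ>\<^bsub>S \<times> S\<^esub> (cc_unit X S \<otimes>\<^sub>m mat_id S)) t c = lunit S t c"
    proof (cases "snd t \<in> S \<and> c \<in> S")
      case True
      then show ?thesis using cc_mult_unit_left[of "snd t" c]
        by (cases t) (simp add: mat_comp_tensor_id_right[OF finite_S] lunit_def mat_of_fun_def)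
    next
      case False
      then show ?thesis
        by (cases t) (auto simp: mat_comp_tensor_id_right[OF finite_S] lunit_def mat_of_fun_def cc_mult_def)
    qed
  qed
  moreover have "?m \<circ>\<^bsub>S \<times> S\<^esub> (mat_id S \<otimes>\<^sub>m cc_unit X S) = runit S"
  proof (intro ext)
    fix t c
    show "(?m \<circ>\<^bsub>S \<times> S\<^esub> (mat_id S \<otimes>\<^sub>m cc_unit X S)) t c = runit S t c"
    proof (cases "fst t \<in> S \<and> c \<in> S")
      case True
      then show ?thesis using cc_mult_unit_right[of "fst t" c]
        by (cases t) (simp add: mat_comp_tensor_id_left[OF finite_S] runit_def mat_of_fun_def)
    next
      case False
      then show ?thesis
        by (cases t) (auto simp: mat_comp_tensor_id_left[OF finite_S] runit_def mat_of_fun_def cc_mult_def)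
    qed
  qed
  moreover have "?m \<in> mat_hom (S \<times> S) S" "cc_unit X S \<in> mat_hom unit_obj S"
    by (auto simp: mat_hom_def cc_mult_def cc_unit_def)
  ultimately show ?thesis
    unfolding mat_monoid_def using finite_S by blast
qed

section \<open>Forms positive exactly on the diagonal\<close>

context
  fixes f :: "('a rel, unit) matrix"
  assumes f: "f \<in> mat_hom S unit_obj" and f_pos: "\<forall>a\<in>S. f a () > 0 \<longleftrightarrow> a \<subseteq> Id_on X"
begin

lemma form_nonneg: "(f \<circ>\<^bsub>S\<^esub> cc_mult X S) p () \<ge> 0"
  using f by (auto simp: mat_comp_def mat_hom_def cc_mult_nonneg intro!: sum_nonneg mult_nonneg_nonneg)

text \<open>All summands are non-negative, so the entry is positive iff some diagonal class
  \<open>c\<close> has a positive intersection number. At a point \<open>(x, x)\<close> of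
  \<open>c\<close> this means that some \<open>z\<close> has \<open>(x, z)\<close> in
  \<open>a\<close> and \<open>(z, x)\<close> in \<open>b\<close>.\<close>

lemma form_pos_iff:
  assumes "a \<in> S" "b \<in> S"
  shows "(f \<circ>\<^bsub>S\<^esub> cc_mult X S) (a, b) () > 0 \<longleftrightarrow> b \<inter> a\<inverse> \<noteq> {}"
proof -
  have nonneg: "cc_mult X S (a, b) c * f c () \<ge> 0" if "c \<in> S" for c
    using f that by (auto simp: mat_hom_def cc_mult_nonneg)
  have mult_pos: "cc_mult X S (a, b) c > 0 \<longleftrightarrow> (\<exists>z. (x, z) \<in> a \<and> (z, y) \<in> b)"
    if "c \<in> S" "(x, y) \<in> c" for c x y
    using that assms intersection_number_eq[OF assms that] finite_X class_subset[of a]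
    by (auto simp: cc_mult_def card_gt_0_iff)
  have "(f \<circ>\<^bsub>S\<^esub> cc_mult X S) (a, b) () > 0 \<longleftrightarrow> (\<exists>c\<in>S. cc_mult X S (a, b) c * f c () > 0)"
  proof -
    have "0 < (\<Sum>c\<in>S. cc_mult X S (a, b) c * f c ())
        \<longleftrightarrow> (\<Sum>c\<in>S. cc_mult X S (a, b) c * f c ()) \<noteq> 0"
      using sum_nonneg[of S "\<lambda>c. cc_mult X S (a, b) c * f c ()"] nonneg by (auto simp: less_le)
    also have "\<dots> \<longleftrightarrow> (\<exists>c\<in>S. cc_mult X S (a, b) c * f c () \<noteq> 0)"
      by (subst sum_nonneg_eq_0_iff[OF finite_S nonneg]) auto
    also have "\<dots> \<longleftrightarrow> (\<exists>c\<in>S. cc_mult X S (a, b) c * f c () > 0)"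
      using nonneg by (intro bex_cong) (auto simp: less_le)
    finally show ?thesis by (simp add: mat_comp_def)
  qed
  also have "\<dots> \<longleftrightarrow> (\<exists>c\<in>S. cc_mult X S (a, b) c > 0 \<and> c \<subseteq> Id_on X)"
    using f_pos cc_mult_nonneg[of "(a, b)"]
    by (intro bex_cong) (auto simp: zero_less_mult_iff dest: leD)
  also have "\<dots> \<longleftrightarrow> b \<inter> a\<inverse> \<noteq> {}"
  proof
    assume "\<exists>c\<in>S. cc_mult X S (a, b) c > 0 \<and> c \<subseteq> Id_on X"
    then obtain c where c: "c \<in> S" "cc_mult X S (a, b) c > 0" "c \<subseteq> Id_on X" by blast
    then obtain x y where "(x, y) \<in> c" using class_nonempty by blast
    with c show "b \<inter> a\<inverse> \<noteq> {}" using mult_pos[of c x y] by auto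
  next
    assume "b \<inter> a\<inverse> \<noteq> {}"
    then obtain x z where xz: "(x, z) \<in> a" "(z, x) \<in> b" by auto
    \<comment> \<open>By CC2 the class of \<open>(x, x)\<close> is diagonal, and \<open>z\<close>
      witnesses that its intersection number is positive.\<close>
    then obtain c where "c \<in> S" "(x, x) \<in> c"
      using ex_class[of "(x, x)"] class_subset[OF assms(1)] by auto
    with xz show "\<exists>c\<in>S. cc_mult X S (a, b) c > 0 \<and> c \<subseteq> Id_on X"
      using mult_pos[of c x x] class_subset_Id[of c] by blast
  qed
  finally show ?thesis .
qed

lemma CC4_if_nondegenerate:
  assumes "nondegenerate_form S (cc_mult X S) (cc_unit X S) f"
  shows "CC4 S"
proof -
  let ?E = "\<lambda>a b. (f \<circ>\<^bsub>S\<^esub> cc_mult X S) (a, b) ()"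
  obtain \<eta> where \<eta>: "\<eta> \<in> mat_hom unit_obj (S \<times> S)" "snake_identities S (f \<circ>\<^bsub>S\<^esub> cc_mult X S) \<eta>"
    using assms by (auto simp: nondegenerate_form_def)
  note snake = \<eta>(2)[unfolded snake_identities_iff[OF finite_S], THEN conjunct1, rule_format]
    \<eta>(2)[unfolded snake_identities_iff[OF finite_S], THEN conjunct2, rule_format]
  have ex: "\<exists>b\<in>S. a\<inverse> \<subseteq> b" if a: "a \<in> S" for a
  proof -
    obtain b where b: "b \<in> S" "\<And>b'. b' \<in> S \<Longrightarrow> ?E a b' > 0 \<Longrightarrow> b' = b"
    proof (rule nonneg_inverse_unique_entry[of S ?E "\<lambda>a b. \<eta> () (a, b)" a])
      show "0 \<le> \<eta> () (b, c)" if "b \<in> S" "c \<in> S" for b c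
        using \<eta>(1) that by (simp add: mat_hom_def)
    qed (use finite_S form_nonneg snake a in blast)+
    have "(y, x) \<in> b" if xy: "(x, y) \<in> a" for x y
    proof -
      \<comment> \<open>The class of \<open>(y, x)\<close> meets \<open>a\<inverse>\<close>, so its
        entry in row \<open>a\<close> is positive and it must be \<open>b\<close>.\<close>
      obtain b' where b': "b' \<in> S" "(y, x) \<in> b'"
        using ex_class[of "(y, x)"] class_subset[OF a] xy by auto
      then show ?thesis using b form_pos_iff[OF a] xy by blast
    qed
    then show ?thesis using b by auto
  qed
  have "a\<inverse> \<in> S" if a: "a \<in> S" for a
  proof -
    obtain b where b: "b \<in> S" "a\<inverse> \<subseteq> b" using ex a by blast
    \<comment> \<open>Applying the inclusion twice puts \<open>a\<close> inside
      \<open>b\<inverse>\<close> and that inside \<open>a'\<close>. Classes that share a point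
      coincide, so all three are equal.\<close>
    obtain a' where a': "a' \<in> S" "b\<inverse> \<subseteq> a'" using ex b by blast
    obtain x y where xy: "(x, y) \<in> a" using class_nonempty a by blast
    have "a = a'" using class_eqI[OF a a'(1) xy] xy b a' by blast
    then have "a\<inverse> = b" using b a' by auto
    then show ?thesis using b by simp
  qed
  then show ?thesis by (simp add: CC4_def)
qed

lemma nondegenerate_if_CC4:
  assumes "CC4 S"
  shows "nondegenerate_form S (cc_mult X S) (cc_unit X S) f"
proof -
  let ?\<epsilon> = "f \<circ>\<^bsub>S\<^esub> cc_mult X S"
  \<comment> \<open>The matrix of the form has one positive entry per row, at
    \<open>(c, c\<inverse>)\<close>. Its inverse has the reciprocal at the transposed position
    \<open>(c\<inverse>, c)\<close>.\<close>
  define \<eta> :: "(unit, 'a rel \<times> 'a rel) matrix"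
    where "\<eta> = (\<lambda>_ (b, c). if c \<in> S \<and> b = c\<inverse> then 1 / ?\<epsilon> (c, b) () else 0)"
  have conv: "a\<inverse> \<in> S" if "a \<in> S" for a
    using assms that by (simp add: CC4_def)
  have pos: "?\<epsilon> (a, a\<inverse>) () > 0" if "a \<in> S" for a
    using form_pos_iff[of a "a\<inverse>"] conv that class_nonempty[OF that] by auto
  \<comment> \<open>By CC4 \<open>a\<inverse>\<close> is itself a class, so every other class is
    disjoint from it.\<close>
  have zero: "?\<epsilon> (a, b) () = 0" if "a \<in> S" "b \<in> S" "b \<noteq> a\<inverse>" for a b
    using form_pos_iff[of a b] form_nonneg[of "(a, b)"] that class_eqI[OF that(2) conv[OF that(1)]]
    by (auto simp: less_le)
  have "(\<Sum>b\<in>S. \<eta> () (b, c) * ?\<epsilon> (a, b) ()) = of_bool (a = c)" if "a \<in> S" "c \<in> S" for a c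
  proof -
    have "(\<Sum>b\<in>S. \<eta> () (b, c) * ?\<epsilon> (a, b) ()) = (\<Sum>b\<in>S. if a\<inverse> = b then of_bool (a = c) else 0)"
      using that zero pos[of a] by (intro sum.cong) (auto simp: \<eta>_def)
    then show ?thesis using finite_S conv that by simp
  qed
  moreover have "(\<Sum>c\<in>S. \<eta> () (b, c) * ?\<epsilon> (c, a) ()) = of_bool (a = b)" if "a \<in> S" "b \<in> S" for a b
  proof -
    \<comment> \<open>Only \<open>c = a\<inverse>\<close> pairs with \<open>a\<close>. There
      \<open>\<eta>\<close> is nonzero exactly for \<open>b = c\<inverse> = a\<close>, where the
      reciprocal cancels.\<close>
    have "(\<Sum>c\<in>S. \<eta> () (b, c) * ?\<epsilon> (c, a) ()) = (\<Sum>c\<in>S. if a\<inverse> = c then of_bool (a = b) else 0)"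
    proof (intro sum.cong refl)
      fix c assume "c \<in> S"
      show "\<eta> () (b, c) * ?\<epsilon> (c, a) () = (if a\<inverse> = c then of_bool (a = b) else 0)"
      proof (cases "a\<inverse> = c")
        case True
        then show ?thesis using pos[OF \<open>c \<in> S\<close>] \<open>c \<in> S\<close> by (auto simp: \<eta>_def)
      next
        case False
        then have "a \<noteq> c\<inverse>" by auto
        then show ?thesis using zero[OF \<open>c \<in> S\<close> that(1)] False by simp
      qed
    qed
    then show ?thesis using finite_S conv that by simp
  qed
  ultimately have "snake_identities S ?\<epsilon> \<eta>"
    by (simp add: snake_identities_iff[OF finite_S])
  moreover have "\<eta> \<in> mat_hom unit_obj (S \<times> S)"
    using conv form_nonneg by (auto simp: mat_hom_def \<eta>_def)
  ultimately show ?thesis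
    using mat_monoid_cc f by (auto simp: nondegenerate_form_def)
qed

end

end

theorem theorem3p2:
  fixes X :: "'a set" and S :: "'a rel set" and f :: "('a rel, unit) matrix"
  assumes "finite X"
    and "S \<subseteq> Pow (X \<times> X)"
    and "CC1 X S" and "CC2 X S" and "CC3 X S"
    and "f \<in> mat_hom S unit_obj"
    and "\<forall>a\<in>S. f a () > 0 \<longleftrightarrow> a \<subseteq> Id_on X"
  shows "(nondegenerate_form S (cc_mult X S) (cc_unit X S) f \<longleftrightarrow> coherent_configuration X S) \<and>
    (nondegenerate_form S (cc_mult X S) (cc_unit X S) f \<longleftrightarrow> CC4 S)"
proof -
  interpret configuration X S
    using assms by unfold_locales
  show ?thesis
    using CC4_if_nondegenerate[OF assms(6,7)] nondegenerate_if_CC4[OF assms(6,7)] assms(3-5)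
    by (auto simp: coherent_configuration_def)
qed

end
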